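(* For all $x,y,z\in\mathbb{K}\langle x_0,x_1\rangle$, $$(x\sqcup\!\sqcup y)\bullet z=(x\bullet z)\sqcup\!\sqcup y+x\sqcup\!\sqcup(y\bullet z).$$
   Context: $\mathbb{K}$ is a field of characteristic zero. On $\mathbb{K}\langle x_0,x_1\rangle$ (span of words in $x_0,x_1$, $\emptyset$ being the empty word), $\sqcup\!\sqcup$ is the shuffle product ($\emptyset\sqcup\!\sqcup w=w\sqcup\!\sqcup\emptyset=w$, $au\sqcup\!\sqcup bv=a(u\sqcup\!\sqcup bv)+b(au\sqcup\!\sqcup v)$ for letters $a,b$ and words $u,v,w$), and $\bullet$ is the bilinear product determined inductively by: for all words $c,d$, $\emptyset\bullet d=0$, $(x_0c)\bullet d=x_0(c\bullet d)$, $(x_1c)\bullet d=x_1(c\bullet d)+x_0(c\sqcup\!\sqcup d)$. *)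

theory Defs
  imports Main "HOL-Library.Poly_Mapping"
begin

datatype letter = X0 | X1

type_synonym word = "letter list"

text \<open>The space spanned by the words in \<open>x\<^sub>0, x\<^sub>1\<close> over \<open>'k\<close>:
  finitely supported coefficient functions, where \<open>Poly_Mapping.single w 1\<close> is the word \<open>w\<close>.
  The multiplication \<open>(*)\<close> of \<open>Poly_Mapping\<close> plays no role here.\<close>

type_synonym 'k ncpoly = "word \<Rightarrow>\<^sub>0 'k"

definition scale :: "'k \<Rightarrow> 'k ncpoly \<Rightarrow> 'k::field_char_0 ncpoly" where
  "scale c p = Poly_Mapping.map ((*) c) p"

definition lin_ext :: "(word \<Rightarrow> 'k ncpoly) \<Rightarrow> 'k ncpoly \<Rightarrow> 'k::field_char_0 ncpoly" where
  "lin_ext f p = (\<Sum>w\<in>Poly_Mapping.keys p. scale (Poly_Mapping.lookup p w) (f w))"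

definition bilin_ext ::
    "(word \<Rightarrow> word \<Rightarrow> 'k ncpoly) \<Rightarrow> 'k ncpoly \<Rightarrow> 'k ncpoly \<Rightarrow> 'k::field_char_0 ncpoly" where
  "bilin_ext f p q = lin_ext (\<lambda>u. lin_ext (f u) q) p"

definition prepend :: "letter \<Rightarrow> 'k ncpoly \<Rightarrow> 'k::field_char_0 ncpoly" where
  "prepend a = lin_ext (\<lambda>w. Poly_Mapping.single (a # w) 1)"

fun shuffle_word :: "word \<Rightarrow> word \<Rightarrow> 'k::field_char_0 ncpoly" where
  "shuffle_word [] w = Poly_Mapping.single w 1"
| "shuffle_word (a # u) [] = Poly_Mapping.single (a # u) 1"
| "shuffle_word (a # u) (b # v) =
     prepend a (shuffle_word u (b # v)) + prepend b (shuffle_word (a # u) v)"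

fun bullet_word :: "word \<Rightarrow> word \<Rightarrow> 'k::field_char_0 ncpoly" where
  "bullet_word [] d = 0"
| "bullet_word (X0 # c) d = prepend X0 (bullet_word c d)"
| "bullet_word (X1 # c) d = prepend X1 (bullet_word c d) + prepend X0 (shuffle_word c d)"

definition shuffle ::
    "'k ncpoly \<Rightarrow> 'k ncpoly \<Rightarrow> 'k::field_char_0 ncpoly"  (infixl "\<squnion>\<squnion>" 70) where
  "p \<squnion>\<squnion> q = bilin_ext shuffle_word p q"

definition bullet ::
    "'k ncpoly \<Rightarrow> 'k ncpoly \<Rightarrow> 'k::field_char_0 ncpoly"  (infixl "\<bullet>" 70) where
  "p \<bullet> q = bilin_ext bullet_word p q"

lemma scale_one [simp]: "scale 1 p = p"
  by (rule poly_mapping_eqI) (simp add: scale_def Poly_Mapping.map.rep_eq when_def)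

lemma lin_ext_word [simp]: "lin_ext f (Poly_Mapping.single w 1) = f w"
  by (simp add: lin_ext_def)

lemma shuffle_words:
  "Poly_Mapping.single u 1 \<squnion>\<squnion> Poly_Mapping.single v 1 = shuffle_word u v"
  by (simp add: shuffle_def bilin_ext_def)

lemma bullet_words:
  "Poly_Mapping.single u 1 \<bullet> Poly_Mapping.single v 1 = bullet_word u v"
  by (simp add: bullet_def bilin_ext_def)

end

theory Submission
  imports Defs
begin

text \<open>
  Everything is linear in \<open>x\<close>, \<open>y\<close>, \<open>z\<close>, so \<open>x\<close> and \<open>y\<close> may be taken to be words, and one
  inducts on their letters. For \<open>x = a u\<close>, \<open>y = b v\<close> both sides split into the terms with first
  letter \<open>a\<close> and \<open>b\<close>, which agree by the induction hypothesis, and, for each of \<open>a\<close>, \<open>b\<close> equal to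
  \<open>x\<^sub>1\<close>, an extra term with first letter \<open>x\<^sub>0\<close>; the extra terms match because the shuffle product
  is commutative and associative.
\<close>

abbreviation word_poly :: "word \<Rightarrow> 'k::field_char_0 ncpoly" where
  "word_poly w \<equiv> Poly_Mapping.single w 1"

lemma lookup_scale [simp]: "Poly_Mapping.lookup (scale c p) w = c * Poly_Mapping.lookup p w"
  by (simp add: scale_def Poly_Mapping.map.rep_eq when_def)

lemma scale_zero_left [simp]: "scale 0 p = 0"
  and scale_zero_right [simp]: "scale c 0 = 0"
  and scale_add_left: "scale (c + d) p = scale c p + scale d p"
  and scale_add_right: "scale c (p + q) = scale c p + scale c q"
  and scale_scale: "scale c (scale d p) = scale (c * d) p"
  by (rule poly_mapping_eqI; simp add: lookup_add algebra_simps)+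

lemma scale_sum: "scale c (sum f A) = (\<Sum>a\<in>A. scale c (f a))"
  by (induction A rule: infinite_finite_induct) (simp_all add: scale_add_right)

text \<open>Words span the space, so an identity linear in a variable need only be checked on words
  for that variable.\<close>

lemma ncpoly_induct [case_names word add scale]:
  fixes p :: "'k::field_char_0 ncpoly"
  assumes word: "\<And>w. P (word_poly w)"
    and add: "\<And>p q. P p \<Longrightarrow> P q \<Longrightarrow> P (p + q)"
    and scale: "\<And>c p. P p \<Longrightarrow> P (scale c p)"
  shows "P p"
proof (induction p rule: update_induct)
  case const
  \<comment> \<open>Zero is a multiple of a word, so the \<open>scale\<close> case covers
    it.\<close>
  have "scale 0 (word_poly []) = (0 :: 'k ncpoly)"
    by simp
  then show ?case
    using scale word by metis
next
  case (update p w c)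
  \<comment> \<open>Here \<open>w\<close> is not a key of \<open>p\<close>, so overwriting its
    coefficient 0 amounts to adding a multiple of \<open>w\<close>.\<close>
  have "Poly_Mapping.update w c p = p + scale c (word_poly w)"
    by (rule poly_mapping_eqI)
      (use update in \<open>auto simp: lookup_update lookup_add lookup_single in_keys_iff when_def\<close>)
  then show ?case
    using update add scale word by metis
qed

text \<open>Addition and scaling may change the set of keys; a common finite index set makes the
  sums comparable.\<close>

lemma lin_ext_superset:
  assumes "finite A" "Poly_Mapping.keys p \<subseteq> A"
  shows "lin_ext f p = (\<Sum>w\<in>A. scale (Poly_Mapping.lookup p w) (f w))"
  unfolding lin_ext_def
  by (rule sum.mono_neutral_left) (use assms in \<open>auto simp: in_keys_iff\<close>)

lemma lin_ext_add: "lin_ext f (p + q) = lin_ext f p + lin_ext f q"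
proof -
  let ?A = "Poly_Mapping.keys p \<union> Poly_Mapping.keys q"
  show ?thesis
    using Poly_Mapping.keys_add[of p q]
    by (simp add: lin_ext_superset[of ?A] lookup_add scale_add_left sum.distrib)
qed

lemma lin_ext_scale: "lin_ext f (scale c p) = scale c (lin_ext f p)"
proof -
  have "Poly_Mapping.keys (scale c p) \<subseteq> Poly_Mapping.keys p"
    by (auto simp: in_keys_iff)
  then show ?thesis
    by (simp add: lin_ext_superset[of "Poly_Mapping.keys p"] scale_scale scale_sum)
qed

lemma lin_ext_fun_add: "lin_ext (\<lambda>w. f w + g w) p = lin_ext f p + lin_ext g p"
  by (simp add: lin_ext_def scale_add_right sum.distrib)

lemma lin_ext_fun_scale: "lin_ext (\<lambda>w. scale c (f w)) p = scale c (lin_ext f p)"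
  by (simp add: lin_ext_def scale_sum scale_scale mult.commute)

lemmas linear_simps =
  lin_ext_add lin_ext_scale lin_ext_fun_add lin_ext_fun_scale

lemma prepend_word [simp]: "prepend a (word_poly w) = word_poly (a # w)"
  by (simp add: prepend_def)

lemma prepend_add: "prepend a (p + q) = prepend a p + prepend a q"
  and prepend_scale: "prepend a (scale c p) = scale c (prepend a p)"
  by (simp_all add: prepend_def linear_simps)

lemma shuffle_add_left: "(p + q) \<squnion>\<squnion> r = p \<squnion>\<squnion> r + q \<squnion>\<squnion> r"
  and shuffle_add_right: "r \<squnion>\<squnion> (p + q) = r \<squnion>\<squnion> p + r \<squnion>\<squnion> q"
  and shuffle_scale_left: "scale c p \<squnion>\<squnion> r = scale c (p \<squnion>\<squnion> r)"
  and shuffle_scale_right: "r \<squnion>\<squnion> scale c p = scale c (r \<squnion>\<squnion> p)"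
  by (simp_all add: shuffle_def bilin_ext_def linear_simps)

lemma bullet_add_left: "(p + q) \<bullet> r = p \<bullet> r + q \<bullet> r"
  and bullet_add_right: "r \<bullet> (p + q) = r \<bullet> p + r \<bullet> q"
  and bullet_scale_left: "scale c p \<bullet> r = scale c (p \<bullet> r)"
  and bullet_scale_right: "r \<bullet> scale c p = scale c (r \<bullet> p)"
  by (simp_all add: bullet_def bilin_ext_def linear_simps)

lemmas multilinear_simps =
  scale_add_right prepend_add prepend_scale
  shuffle_add_left shuffle_add_right shuffle_scale_left shuffle_scale_right
  bullet_add_left bullet_add_right bullet_scale_left bullet_scale_right

lemma shuffle_Nil_left [simp]: "word_poly [] \<squnion>\<squnion> p = p"
  by (induction p rule: ncpoly_induct) (simp_all add: multilinear_simps shuffle_words)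

lemma shuffle_Nil_right [simp]: "p \<squnion>\<squnion> word_poly [] = p"
proof (induction p rule: ncpoly_induct)
  case (word w)
  show ?case
    by (cases w) (simp_all add: shuffle_words)
qed (simp_all add: multilinear_simps)

text \<open>On words this is the recursion of \<open>shuffle_word\<close>; both sides are bilinear
  in \<open>p\<close> and \<open>q\<close>.\<close>

lemma shuffle_prepend:
  "prepend a p \<squnion>\<squnion> prepend b q = prepend a (p \<squnion>\<squnion> prepend b q) + prepend b (prepend a p \<squnion>\<squnion> q)"
proof (induction p rule: ncpoly_induct)
  case (word u)
  show ?case
    by (induction q rule: ncpoly_induct)
      (simp_all add: multilinear_simps shuffle_words add_ac)
qed (simp_all add: multilinear_simps add_ac)

text \<open>The simplifier folds \<open>prepend a (word_poly u)\<close> into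
  \<open>word_poly (a # u)\<close>, so the recursion is also provided in folded form.\<close>

lemmas shuffle_Cons =
  shuffle_prepend[where p = "word_poly u" and q = "word_poly v" for u v, unfolded prepend_word]
  shuffle_prepend[where p = "word_poly u" for u, unfolded prepend_word]
  shuffle_prepend[where q = "word_poly v" for v, unfolded prepend_word]

lemma shuffle_word_commute: "word_poly u \<squnion>\<squnion> word_poly v = word_poly v \<squnion>\<squnion> word_poly u"
proof (induction u v rule: shuffle_word.induct)
  case (3 a u b v)
  then show ?case
    by (simp add: shuffle_Cons add.commute)
qed simp_all

lemma shuffle_commute: "p \<squnion>\<squnion> q = q \<squnion>\<squnion> p"
proof (induction p rule: ncpoly_induct)
  case (word u)
  show ?case
    by (induction q rule: ncpoly_induct) (simp_all add: multilinear_simps shuffle_word_commute)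
qed (simp_all add: multilinear_simps)

text \<open>Both bracketings split by first letter into three terms. Each term shortens exactly one
  of the three words, which is what the nested inductions provide for.\<close>

lemma shuffle_word_assoc:
  "word_poly u \<squnion>\<squnion> word_poly v \<squnion>\<squnion> word_poly w =
    (word_poly u \<squnion>\<squnion> (word_poly v \<squnion>\<squnion> word_poly w) :: 'k::field_char_0 ncpoly)"
proof (induction u arbitrary: v w)
  case (Cons a u)
  note IH_u = this
  show ?case
  proof (induction v arbitrary: w)
    case (Cons b v)
    note IH_v = this
    show ?case
    proof (induction w)
      case (Cons c w)
      let ?u = "word_poly (a # u) :: 'k ncpoly"
      let ?v = "word_poly (b # v) :: 'k ncpoly"
      let ?w = "word_poly (c # w) :: 'k ncpoly"
      have "?u \<squnion>\<squnion> ?v \<squnion>\<squnion> ?w =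
          prepend a (word_poly u \<squnion>\<squnion> ?v \<squnion>\<squnion> ?w) + prepend b (?u \<squnion>\<squnion> word_poly v \<squnion>\<squnion> ?w)
          + prepend c (?u \<squnion>\<squnion> ?v \<squnion>\<squnion> word_poly w)"
        by (simp add: shuffle_Cons multilinear_simps add_ac)
      also have "\<dots> = prepend a (word_poly u \<squnion>\<squnion> (?v \<squnion>\<squnion> ?w)) + prepend b (?u \<squnion>\<squnion> (word_poly v \<squnion>\<squnion> ?w))
          + prepend c (?u \<squnion>\<squnion> (?v \<squnion>\<squnion> word_poly w))"
        by (simp only: IH_u IH_v Cons)
      also have "\<dots> = ?u \<squnion>\<squnion> (?v \<squnion>\<squnion> ?w)"
        by (simp add: shuffle_Cons multilinear_simps add_ac)
      finally show ?case .
    qed simp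
  qed simp
qed simp

lemma shuffle_assoc: "p \<squnion>\<squnion> q \<squnion>\<squnion> r = p \<squnion>\<squnion> (q \<squnion>\<squnion> r)"
proof (induction p rule: ncpoly_induct)
  case (word u)
  show ?case
  proof (induction q rule: ncpoly_induct)
    case (word v)
    show ?case
      by (induction r rule: ncpoly_induct) (simp_all add: multilinear_simps shuffle_word_assoc)
  qed (simp_all add: multilinear_simps)
qed (simp_all add: multilinear_simps)

lemma shuffle_right_commute: "p \<squnion>\<squnion> q \<squnion>\<squnion> r = p \<squnion>\<squnion> r \<squnion>\<squnion> q"
  by (metis shuffle_assoc shuffle_commute)

text \<open>The correction that arises when \<open>prepend a\<close> is pulled out of the left
  argument of \<open>\<bullet>\<close>. It lets both letters be treated uniformly.\<close>

definition extra :: "letter \<Rightarrow> 'k::field_char_0 ncpoly \<Rightarrow> 'k ncpoly" where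
  "extra a p = (if a = X1 then prepend X0 p else 0)"

lemma extra_add: "extra a (p + q) = extra a p + extra a q"
  and extra_scale: "extra a (scale c p) = scale c (extra a p)"
  by (simp_all add: extra_def multilinear_simps)

lemma zero_shuffle [simp]: "0 \<squnion>\<squnion> p = 0" "p \<squnion>\<squnion> 0 = 0"
  using shuffle_scale_left[of 0 0 p] shuffle_scale_right[of p 0 0] by simp_all

lemma prepend_zero [simp]: "prepend a 0 = 0"
  using prepend_scale[of a 0 0] by simp

text \<open>A nonzero \<open>extra a p\<close> starts with \<open>X0\<close>, so this is an instance
  of \<open>shuffle_prepend\<close>.\<close>

lemma extra_shuffle_prepend:
  "extra a p \<squnion>\<squnion> prepend b q = extra a (p \<squnion>\<squnion> prepend b q) + prepend b (extra a p \<squnion>\<squnion> q)"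
  by (simp add: extra_def shuffle_prepend)

lemma bullet_Nil [simp]: "word_poly [] \<bullet> z = 0"
  by (induction z rule: ncpoly_induct) (simp_all add: multilinear_simps bullet_words)

text \<open>The two nonempty cases of \<open>bullet_word\<close> in one formula, extended bilinearly
  from words.\<close>

lemma bullet_prepend: "prepend a p \<bullet> z = prepend a (p \<bullet> z) + extra a (p \<squnion>\<squnion> z)"
proof (induction p rule: ncpoly_induct)
  case (word u)
  show ?case
  proof (induction z rule: ncpoly_induct)
    case (word v)
    show ?case
      by (cases a) (simp_all add: extra_def bullet_words shuffle_words)
  qed (simp_all add: multilinear_simps extra_add extra_scale add_ac)
qed (simp_all add: multilinear_simps extra_add extra_scale add_ac)

text \<open>Expanding \<open>prepend a p \<bullet> z\<close> gives two summands. Shuffling each with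
  \<open>prepend b q\<close> yields two terms starting with \<open>b\<close>, which recombine into
  the last one; right commutativity moves \<open>z\<close> to the end.\<close>

lemma bullet_prepend_shuffle_prepend:
  "(prepend a p \<bullet> z) \<squnion>\<squnion> prepend b q =
     prepend a ((p \<bullet> z) \<squnion>\<squnion> prepend b q) + extra a (p \<squnion>\<squnion> prepend b q \<squnion>\<squnion> z)
     + prepend b ((prepend a p \<bullet> z) \<squnion>\<squnion> q)"
  by (simp add: bullet_prepend multilinear_simps shuffle_prepend extra_shuffle_prepend
      shuffle_right_commute[of p z] add_ac)

text \<open>The recursion consumes letters of \<open>u\<close> and \<open>v\<close> only, so
  \<open>z\<close> stays an arbitrary element.\<close>

lemma bullet_shuffle_words:
  "(word_poly u \<squnion>\<squnion> word_poly v) \<bullet> z = (word_poly u \<bullet> z) \<squnion>\<squnion> word_poly v + word_poly u \<squnion>\<squnion> (word_poly v \<bullet> z)"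
proof (induction u v rule: shuffle_word.induct)
  case (3 a u b v)
  let ?u = "word_poly u" and ?v = "word_poly v"
  \<comment> \<open>Keeping \<open>prepend\<close> visible lets the rules for prepended arguments
    apply directly.\<close>
  let ?au = "prepend a ?u" and ?bv = "prepend b ?v"
  have "(?au \<squnion>\<squnion> ?bv) \<bullet> z =
      prepend a ((?u \<squnion>\<squnion> ?bv) \<bullet> z) + extra a (?u \<squnion>\<squnion> ?bv \<squnion>\<squnion> z)
      + (prepend b ((?au \<squnion>\<squnion> ?v) \<bullet> z) + extra b (?au \<squnion>\<squnion> ?v \<squnion>\<squnion> z))"
    by (simp only: shuffle_prepend bullet_add_left bullet_prepend)
  also have "\<dots> =
      prepend a ((?u \<bullet> z) \<squnion>\<squnion> ?bv + ?u \<squnion>\<squnion> (?bv \<bullet> z)) + extra a (?u \<squnion>\<squnion> ?bv \<squnion>\<squnion> z)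
      + (prepend b ((?au \<bullet> z) \<squnion>\<squnion> ?v + ?au \<squnion>\<squnion> (?v \<bullet> z)) + extra b (?au \<squnion>\<squnion> ?v \<squnion>\<squnion> z))"
    using 3 by simp
  \<comment> \<open>Commutativity regroups the terms into two blocks that differ by exchanging the
    roles of \<open>?au\<close> and \<open>?bv\<close>.\<close>
  also have "\<dots> =
      (prepend a ((?u \<bullet> z) \<squnion>\<squnion> ?bv) + extra a (?u \<squnion>\<squnion> ?bv \<squnion>\<squnion> z) + prepend b ((?au \<bullet> z) \<squnion>\<squnion> ?v))
      + (prepend b ((?v \<bullet> z) \<squnion>\<squnion> ?au) + extra b (?v \<squnion>\<squnion> ?au \<squnion>\<squnion> z) + prepend a ((?bv \<bullet> z) \<squnion>\<squnion> ?u))"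
    by (simp only: prepend_add add_ac shuffle_commute[of ?u "?bv \<bullet> z"]
        shuffle_commute[of ?au "?v \<bullet> z"] shuffle_commute[of ?au ?v])
  \<comment> \<open>Each block is the right-hand side of
    \<open>bullet_prepend_shuffle_prepend\<close>, the second with the two words exchanged.\<close>
  also have "\<dots> = (?au \<bullet> z) \<squnion>\<squnion> ?bv + ?au \<squnion>\<squnion> (?bv \<bullet> z)"
    by (simp only: bullet_prepend_shuffle_prepend shuffle_commute[of ?au "?bv \<bullet> z"])
  finally show ?case
    by simp
qed simp_all

theorem proposition14:
  fixes x y z :: "'k::field_char_0 ncpoly"
  shows "(x \<squnion>\<squnion> y) \<bullet> z = (x \<bullet> z) \<squnion>\<squnion> y + x \<squnion>\<squnion> (y \<bullet> z)"
proof (induction x rule: ncpoly_induct)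
  case (word u)
  show ?case
    by (induction y rule: ncpoly_induct)
      (simp_all add: multilinear_simps bullet_shuffle_words add_ac)
qed (simp_all add: multilinear_simps add_ac)

end
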